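(* Let $M>0$ be a constant and let $f:\mathbb{D}\to\mathbb{C}$ be a harmonic mapping with $\sup_{z\in\mathbb{D}}|f(z)|\leq M$. Then for every integer $n\geq 1$ and every $z\in\mathbb{D}$, $$\left|\frac{\partial^{n} f}{\partial z^{n}}(z)\right|+\left|\frac{\partial^{n} f}{\partial \overline{z}^{n}}(z)\right|\leq\frac{n!\,4M}{\pi}\,\frac{1}{(1-|z|)^{n}(1+|z|)}.$$ The estimate is sharp at $z=0$, i.e. for each $n\ge 1$ and $M>0$ there is such an $f$ for which equality holds at $z=0$.
   Context: $\mathbb{D}=\{z\in\mathbb{C}:|z|<1\}$ is the open unit disk. A harmonic mapping of $\mathbb{D}$ into $\mathbb{C}$ is a complex-valued harmonic function on $\mathbb{D}$, not necessarily injective; equivalently $f=h+\overline{g}$ with $h,g$ analytic in $\mathbb{D}$. The operators $\partial/\partial z$ and $\partial/\partial\overline{z}$ are the Wirtinger derivatives. *)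

theory Defs
  imports "HOL-Analysis.Analysis"
begin

definition dx :: "(complex \<Rightarrow> complex) \<Rightarrow> complex \<Rightarrow> complex" where
  "dx f z = frechet_derivative f (at z) 1"

definition dy :: "(complex \<Rightarrow> complex) \<Rightarrow> complex \<Rightarrow> complex" where
  "dy f z = frechet_derivative f (at z) \<i>"

definition wirtinger_dz :: "(complex \<Rightarrow> complex) \<Rightarrow> complex \<Rightarrow> complex" where
  "wirtinger_dz f z = (dx f z - \<i> * dy f z) / 2"

definition wirtinger_dzbar :: "(complex \<Rightarrow> complex) \<Rightarrow> complex \<Rightarrow> complex" where
  "wirtinger_dzbar f z = (dx f z + \<i> * dy f z) / 2"

(* Real differentiability; dx and dy are arbitrary values where it fails,
   so it has to be required separately. *)
definition C1_on :: "(complex \<Rightarrow> complex) \<Rightarrow> complex set \<Rightarrow> bool" where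
  "C1_on f S \<longleftrightarrow> (\<forall>z\<in>S. f differentiable (at z)) \<and>
     continuous_on S (dx f) \<and> continuous_on S (dy f)"

definition C2_on :: "(complex \<Rightarrow> complex) \<Rightarrow> complex set \<Rightarrow> bool" where
  "C2_on f S \<longleftrightarrow> C1_on f S \<and> C1_on (dx f) S \<and> C1_on (dy f) S"

definition harmonic_on :: "(complex \<Rightarrow> complex) \<Rightarrow> complex set \<Rightarrow> bool" where
  "harmonic_on f S \<longleftrightarrow> open S \<and> C2_on f S \<and>
     (\<forall>z\<in>S. dx (dx f) z + dy (dy f) z = 0)"

end

theory Submission
  imports Defs "HOL-Complex_Analysis.Complex_Analysis"
begin

text \<open>A harmonic \<open>f\<close> on the disc is \<open>h + cnj g\<close> with \<open>h\<close>, \<open>g\<close> holomorphic (\<open>harmonic_on_convex_decomposition\<close>; this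
  rests on the symmetry of second derivatives), and for \<open>n \<ge> 1\<close> the two Wirtinger derivatives have
  the norms of the \<open>n\<close>-th derivatives of \<open>h\<close> and \<open>g\<close>. So the claim is about \<open>\<bar>a\<bar> + \<bar>b\<bar>\<close>, where, after
  division by \<open>n!\<close>, \<open>a\<close> and \<open>b\<close> are these derivatives at \<open>z\<close>, the second one conjugated.

  Suppose first that \<open>h\<close> and \<open>g\<close> are continuous up to the unit circle. By Cauchy's formula \<open>a\<close> and \<open>b\<close> are the mean
  values over the circle of \<open>f * K\<close> and \<open>f * cnj K\<close>, with \<open>K u = u / (u - z) ^ (n + 1)\<close>. Choosing \<open>\<bar>c\<bar> = 1\<close> such that
  \<open>\<bar>a\<bar> + \<bar>b\<bar> = \<bar>c * a + cnj c * b\<bar>\<close> gives \<open>\<bar>a\<bar> + \<bar>b\<bar> \<le> 2 * M * (mean value of \<bar>Re (c * K)\<bar>)\<close>.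

  Everything thus depends on the mean value of \<open>\<bar>Re (c * K)\<bar>\<close>, and the point of the proof is that it is bounded by
  \<open>2 / pi\<close> times the expected constant \<open>1 / ((1 - \<bar>z\<bar>) ^ n * (1 + \<bar>z\<bar>))\<close> (\<open>integral_abs_Re_Cauchy_kernel_le\<close>).
  The modulus of \<open>K\<close> is at most that constant times the Poisson kernel of \<open>z\<close>. Its direction enters only through
  \<open>cnj (c * K) / (c * K)\<close>, which on the circle is a Blaschke product \<open>B\<close> with \<open>B z = 0\<close>. Since all Poisson
  integrals of \<open>B ^ k\<close>, \<open>k \<ge> 1\<close>, vanish at \<open>z\<close>, \<open>B\<close> is uniformly distributed on the circle with respect
  to the Poisson kernel (\<open>integral_mult_comp_Re\<close>), and the mean value of \<open>\<bar>cos\<bar>\<close> is \<open>2 / pi\<close>.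

  The continuity on the boundary is removed by dilation (\<open>higher_deriv_bound_disc\<close>). For sharpness,
  \<open>(2*M/pi) * Arg ((1 + z ^ n) / (1 - z ^ n))\<close> takes the values \<open>\<plusminus>M\<close> on the boundary with the sign
  pattern that makes the estimate an equality at \<open>0\<close> (\<open>exists_extremal_harmonic\<close>).\<close>

section \<open>Symmetry of second derivatives and the canonical decomposition\<close>

text \<open>The symmetric second difference is what makes the order of differentiation irrelevant. As a
  function of \<open>s\<close>, the difference \<open>f (z + t *\<^sub>R b + s *\<^sub>R a) - f (z + s *\<^sub>R a)\<close> has derivative
  \<open>p (z + t *\<^sub>R b + s *\<^sub>R a) - p (z + s *\<^sub>R a)\<close>, where \<open>p\<close> is the derivative of \<open>f\<close> in direction \<open>a\<close>;
  the linear approximation of \<open>p\<close> at \<open>z\<close> turns this into \<open>t\<close> times the \<open>b\<close>-derivative of \<open>p\<close>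
  up to \<open>o(t)\<close>, and the mean value inequality on \<open>{0..t}\<close> gives the limit.\<close>
lemma second_difference_tendsto:
  fixes f :: "complex \<Rightarrow> complex"
  assumes S: "open S" "z \<in> S"
    and f: "\<And>w. w \<in> S \<Longrightarrow> f differentiable (at w)"
    and D: "(\<lambda>w. frechet_derivative f (at w) a) differentiable (at z)"
  shows "((\<lambda>t::real. (f (z + t *\<^sub>R a + t *\<^sub>R b) - f (z + t *\<^sub>R a) - f (z + t *\<^sub>R b) + f z) /\<^sub>R t\<^sup>2)
     \<longlongrightarrow> frechet_derivative (\<lambda>w. frechet_derivative f (at w) a) (at z) b) (at_right 0)"
proof -
  define p where "p = (\<lambda>w. frechet_derivative f (at w) a)"
  define L where "L = frechet_derivative p (at z)"
  have pL: "(p has_derivative L) (at z)"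
    using D unfolding L_def p_def by (simp flip: frechet_derivative_works)
  interpret L: bounded_linear L using pL by (rule has_derivative_bounded_linear)
  define N where "N = cmod a + cmod b"
  have along: "((\<lambda>s. f (q + s *\<^sub>R a)) has_vector_derivative p (q + s *\<^sub>R a)) (at s within T)"
    if "q + s *\<^sub>R a \<in> S" for q s T
  proof -
    have "(f has_derivative frechet_derivative f (at (q + s *\<^sub>R a))) (at (q + s *\<^sub>R a))"
      using f[OF that] by (simp add: frechet_derivative_works)
    moreover have "((\<lambda>s. q + s *\<^sub>R a) has_vector_derivative a) (at s within T)"
      by (auto intro!: derivative_eq_intros)
    ultimately have "((f \<circ> (\<lambda>s. q + s *\<^sub>R a)) has_vector_derivative p (q + s *\<^sub>R a)) (at s within T)"
      unfolding p_def
      by (intro vector_derivative_diff_chain_within) (auto intro: has_derivative_at_withinI)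
    then show ?thesis by (simp only: comp_def)
  qed
  have "\<exists>\<delta>>0. \<forall>t. 0 < t \<and> t < \<delta> \<longrightarrow>
    cmod ((f (z + t *\<^sub>R a + t *\<^sub>R b) - f (z + t *\<^sub>R a) - f (z + t *\<^sub>R b) + f z) /\<^sub>R t\<^sup>2 - L b) \<le> \<epsilon>"
    if "\<epsilon> > 0" for \<epsilon>
  proof -
    \<comment> \<open>The \<open>1\<close> in the denominator only guards against \<open>a = b = 0\<close>.\<close>
    define \<eta> where "\<eta> = \<epsilon> / (2 * N + 1)"
    have N0: "N \<ge> 0" by (simp add: N_def)
    have "\<eta> > 0" using that N0 by (simp add: \<eta>_def)
    obtain d1 where d1: "d1 > 0" "\<And>y. cmod (y - z) < d1 \<Longrightarrow> cmod (p y - p z - L (y - z)) \<le> \<eta> * cmod (y - z)"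
      using pL \<open>\<eta> > 0\<close> unfolding has_derivative_at_alt by blast
    obtain d2 where d2: "d2 > 0" "ball z d2 \<subseteq> S"
      using S open_contains_ball by blast
    define \<delta> where "\<delta> = min d1 d2 / (N + 1)"
    have "\<delta> > 0" using d1 d2 N0 by (simp add: \<delta>_def)
    moreover have "cmod ((f (z + t *\<^sub>R a + t *\<^sub>R b) - f (z + t *\<^sub>R a) - f (z + t *\<^sub>R b) + f z) /\<^sub>R t\<^sup>2 - L b) \<le> \<epsilon>"
      if t: "0 < t" "t < \<delta>" for t
    proof -
      have "t * (N + 1) < min d1 d2"
        using t N0 by (simp add: \<delta>_def pos_less_divide_eq)
      then have tN: "t * N < d1" "t * N < d2" using t by (auto simp: distrib_left)
      have small: "cmod (s *\<^sub>R a + r *\<^sub>R b) \<le> t * N" if "s \<in> {0..t}" "r \<in> {0..t}" for s r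
      proof -
        have "cmod (s *\<^sub>R a + r *\<^sub>R b) \<le> s * cmod a + r * cmod b"
          using that by (intro order_trans[OF norm_triangle_ineq]) auto
        also have "\<dots> \<le> t * cmod a + t * cmod b"
          using that by (intro add_mono mult_right_mono) auto
        finally show ?thesis by (simp add: N_def distrib_left)
      qed
      \<comment> \<open>The linear term is subtracted so that \<open>G\<close> is almost constant on \<open>{0..t}\<close>.\<close>
      define G where "G = (\<lambda>s. f (z + t *\<^sub>R b + s *\<^sub>R a) - f (z + s *\<^sub>R a) - s *\<^sub>R (t *\<^sub>R L b))"
      define G' where "G' = (\<lambda>s. p (z + t *\<^sub>R b + s *\<^sub>R a) - p (z + s *\<^sub>R a) - t *\<^sub>R L b)"
      have inS: "z + t *\<^sub>R b + s *\<^sub>R a \<in> S" "z + s *\<^sub>R a \<in> S" if "s \<in> {0..t}" for s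
      proof -
        have "z + (s *\<^sub>R a + r *\<^sub>R b) \<in> S" if "r \<in> {0..t}" for r
        proof (rule subsetD[OF d2(2)])
          have "dist (z + (s *\<^sub>R a + r *\<^sub>R b)) z < d2"
            using small[OF \<open>s \<in> {0..t}\<close> that] tN unfolding dist_norm by simp
          then show "z + (s *\<^sub>R a + r *\<^sub>R b) \<in> ball z d2" by (simp only: mem_ball dist_commute)
        qed
        from this[of t] this[of 0] t show "z + t *\<^sub>R b + s *\<^sub>R a \<in> S" "z + s *\<^sub>R a \<in> S"
          by (auto simp: add_ac)
      qed
      have deriv: "(G has_vector_derivative G' s) (at s within {0..t})" if "s \<in> {0..t}" for s
        unfolding G_def G'_def
        by (intro has_vector_derivative_diff along inS that) (auto intro!: derivative_eq_intros)
      have lin: "cmod (p (z + (s *\<^sub>R a + r *\<^sub>R b)) - p z - L (s *\<^sub>R a + r *\<^sub>R b)) \<le> \<eta> * (t * N)"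
        if "s \<in> {0..t}" "r \<in> {0..t}" for s r
        using d1(2)[of "z + (s *\<^sub>R a + r *\<^sub>R b)"] small[OF that] tN \<open>\<eta> > 0\<close>
        by (auto intro: order_trans mult_left_mono)
      have bound: "cmod (G' s) \<le> 2 * \<eta> * (t * N)" if "s \<in> {0..t}" for s
      proof -
        have "G' s = (p (z + (s *\<^sub>R a + t *\<^sub>R b)) - p z - L (s *\<^sub>R a + t *\<^sub>R b))
             - (p (z + (s *\<^sub>R a + 0 *\<^sub>R b)) - p z - L (s *\<^sub>R a + 0 *\<^sub>R b))"
          by (simp add: G'_def L.add L.scaleR add_ac)
        then show ?thesis
          using lin[OF that, of t] lin[OF that, of 0] t
            norm_triangle_ineq4[of "p (z + (s *\<^sub>R a + t *\<^sub>R b)) - p z - L (s *\<^sub>R a + t *\<^sub>R b)"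
              "p (z + (s *\<^sub>R a + 0 *\<^sub>R b)) - p z - L (s *\<^sub>R a + 0 *\<^sub>R b)"] by simp
      qed
      have "cmod (G t - G 0) \<le> 2 * \<eta> * (t * N) * norm (t - 0)"
      proof (rule differentiable_bound[of "{0..t}" G "\<lambda>s h. h *\<^sub>R G' s"])
        fix s assume s: "s \<in> {0..t}"
        show "(G has_derivative (\<lambda>h. h *\<^sub>R G' s)) (at s within {0..t})"
          using deriv[OF s] by (simp add: has_vector_derivative_def)
        show "onorm (\<lambda>h. h *\<^sub>R G' s) \<le> 2 * \<eta> * (t * N)"
        proof (rule onorm_le)
          show "norm (h *\<^sub>R G' s) \<le> 2 * \<eta> * (t * N) * norm h" for h
            using mult_right_mono[OF bound[OF s], of "\<bar>h\<bar>"] by (simp add: mult.commute)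
        qed
      qed (use t in auto)
      then have "cmod (G t - G 0) \<le> t\<^sup>2 * (\<eta> * (2 * N))"
        using t by (simp add: power2_eq_square mult_ac)
      also have "\<dots> \<le> t\<^sup>2 * \<epsilon>"
      proof (rule mult_left_mono)
        have "\<eta> * (2 * N) \<le> \<eta> * (2 * N + 1)" using \<open>\<eta> > 0\<close> by simp
        then show "\<eta> * (2 * N) \<le> \<epsilon>" using N0 by (simp add: \<eta>_def split: if_splits)
      qed simp
      finally have *: "cmod (G t - G 0) \<le> t\<^sup>2 * \<epsilon>" .
      have "(f (z + t *\<^sub>R a + t *\<^sub>R b) - f (z + t *\<^sub>R a) - f (z + t *\<^sub>R b) + f z) /\<^sub>R t\<^sup>2 - L b
            = (G t - G 0) /\<^sub>R t\<^sup>2"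
        using t by (simp add: G_def power2_eq_square algebra_simps)
      then have "cmod ((f (z + t *\<^sub>R a + t *\<^sub>R b) - f (z + t *\<^sub>R a) - f (z + t *\<^sub>R b) + f z) /\<^sub>R t\<^sup>2 - L b)
            = cmod (G t - G 0) / t\<^sup>2"
        by (simp add: divide_inverse mult.commute)
      also have "\<dots> \<le> \<epsilon>"
        using * t by (subst pos_divide_le_eq) (simp_all add: mult.commute)
      finally show ?thesis .
    qed
    ultimately show ?thesis by blast
  qed
  note * = this
  show ?thesis
    unfolding L_def[symmetric] p_def[symmetric] tendsto_iff dist_norm
  proof (intro allI impI)
    fix \<epsilon> :: real assume "\<epsilon> > 0"
    then obtain \<delta> where "\<delta> > 0" and \<delta>: "\<forall>t. 0 < t \<and> t < \<delta> \<longrightarrow>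
      cmod ((f (z + t *\<^sub>R a + t *\<^sub>R b) - f (z + t *\<^sub>R a) - f (z + t *\<^sub>R b) + f z) /\<^sub>R t\<^sup>2 - L b) \<le> \<epsilon> / 2"
      using *[of "\<epsilon> / 2"] by auto
    have "\<forall>\<^sub>F t in at_right 0. 0 < t \<and> t < \<delta>"
      using \<open>\<delta> > 0\<close> by (auto simp: eventually_at_right_field)
    then show "\<forall>\<^sub>F t in at_right 0.
       cmod ((f (z + t *\<^sub>R a + t *\<^sub>R b) - f (z + t *\<^sub>R a) - f (z + t *\<^sub>R b) + f z) /\<^sub>R t\<^sup>2 - L b) < \<epsilon>"
    proof eventually_elim
      case (elim t)
      then show ?case using \<delta>[rule_format, of t] \<open>\<epsilon> > 0\<close> by linarith
    qed
  qed
qed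

text \<open>The second difference is symmetric in \<open>a\<close> and \<open>b\<close>, so both iterated derivatives are its limit.\<close>
lemma frechet_derivative_commute:
  fixes f :: "complex \<Rightarrow> complex"
  assumes S: "open S" "z \<in> S"
    and f: "\<And>w. w \<in> S \<Longrightarrow> f differentiable (at w)"
    and D: "(\<lambda>w. frechet_derivative f (at w) a) differentiable (at z)"
           "(\<lambda>w. frechet_derivative f (at w) b) differentiable (at z)"
  shows "frechet_derivative (\<lambda>w. frechet_derivative f (at w) a) (at z) b =
         frechet_derivative (\<lambda>w. frechet_derivative f (at w) b) (at z) a"
proof -
  have "((\<lambda>t::real. (f (z + t *\<^sub>R a + t *\<^sub>R b) - f (z + t *\<^sub>R a) - f (z + t *\<^sub>R b) + f z) /\<^sub>R t\<^sup>2)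
     \<longlongrightarrow> frechet_derivative (\<lambda>w. frechet_derivative f (at w) b) (at z) a) (at_right 0)"
    using second_difference_tendsto[OF S f D(2), of a]
    by (simp add: algebra_simps)
  then show ?thesis
    using second_difference_tendsto[OF S f D(1), of b] tendsto_unique trivial_limit_at_right_real
    by blast
qed

lemma dx_dy_commute:
  assumes "C2_on f S" "open S" "z \<in> S"
  shows "dx (dy f) z = dy (dx f) z"
proof -
  have X: "(\<lambda>w. frechet_derivative f (at w) 1) = dx f"
    and Y: "(\<lambda>w. frechet_derivative f (at w) \<i>) = dy f"
    by (auto simp: dx_def dy_def)
  have "frechet_derivative (dy f) (at z) 1 = frechet_derivative (dx f) (at z) \<i>"
    using assms frechet_derivative_commute[of S z f "\<i>" 1]
    by (simp add: X Y C2_on_def C1_on_def)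
  then show ?thesis by (simp only: dx_def[of "dy f"] dy_def[of "dx f"])
qed

lemma frechet_derivative_dx_dy:
  assumes "f differentiable (at z)"
  shows "frechet_derivative f (at z) w = of_real (Re w) * dx f z + of_real (Im w) * dy f z"
proof -
  interpret bounded_linear "frechet_derivative f (at z)"
    using assms by (intro has_derivative_bounded_linear) (auto simp: frechet_derivative_works)
  have "w = Re w *\<^sub>R 1 + Im w *\<^sub>R \<i>" by (simp add: complex_eq_iff)
  then have "frechet_derivative f (at z) w = Re w *\<^sub>R dx f z + Im w *\<^sub>R dy f z"
    unfolding dx_def dy_def by (metis add scaleR)
  then show ?thesis by (simp add: scaleR_conv_of_real)
qed

lemma has_field_derivative_if_Cauchy_Riemann:
  assumes "f differentiable (at z)" "dy f z = \<i> * dx f z"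
  shows "(f has_field_derivative dx f z) (at z)"
proof -
  have "(f has_derivative frechet_derivative f (at z)) (at z)"
    using assms(1) by (simp add: frechet_derivative_works)
  moreover have "frechet_derivative f (at z) = (*) (dx f z)"
  proof
    fix w
    have "dx f z * w = dx f z * (of_real (Re w) + \<i> * of_real (Im w))"
      by (simp flip: complex_eq)
    then show "frechet_derivative f (at z) w = dx f z * w"
      by (simp only: frechet_derivative_dx_dy[OF assms(1)] assms(2) distrib_left mult_ac)
  qed
  ultimately show ?thesis by (simp add: has_field_derivative_def)
qed

lemma has_derivative_imp_dx_dy:
  assumes "(f has_derivative f') (at z)"
  shows "dx f z = f' 1" "dy f z = f' \<i>"
  using frechet_derivative_at[OF assms] by (auto simp: dx_def dy_def)

text \<open>With equal mixed partials, Laplace's equation for \<open>f\<close> is the Cauchy--Riemann equation for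
  \<open>wirtinger_dz f\<close>.\<close>
lemma harmonic_on_imp_holomorphic_dz:
  assumes "harmonic_on f S"
  shows "wirtinger_dz f holomorphic_on S"
proof -
  have S: "open S" and C2: "C2_on f S" and lap: "\<And>z. z \<in> S \<Longrightarrow> dx (dx f) z + dy (dy f) z = 0"
    using assms by (auto simp: harmonic_on_def)
  have "wirtinger_dz f field_differentiable (at z)" if z: "z \<in> S" for z
  proof -
    have X: "(dx f has_derivative frechet_derivative (dx f) (at z)) (at z)"
      and Y: "(dy f has_derivative frechet_derivative (dy f) (at z)) (at z)"
      using C2 z by (auto simp: C2_on_def C1_on_def simp flip: frechet_derivative_works)
    have W: "(wirtinger_dz f has_derivative
        (\<lambda>w. (frechet_derivative (dx f) (at z) w - \<i> * frechet_derivative (dy f) (at z) w) / 2)) (at z)"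
      unfolding wirtinger_dz_def[abs_def] by (auto intro!: derivative_eq_intros X Y)
    have eqs: "dx (wirtinger_dz f) z = (dx (dx f) z - \<i> * dx (dy f) z) / 2"
      "dy (wirtinger_dz f) z = (dy (dx f) z - \<i> * dy (dy f) z) / 2"
      using has_derivative_imp_dx_dy[OF W] by (simp_all only: dx_def dy_def)
    have "dy (dy f) z = - dx (dx f) z"
      using lap[OF z] by (simp add: add_eq_0_iff)
    then have "dy (wirtinger_dz f) z = \<i> * dx (wirtinger_dz f) z"
      unfolding eqs dx_dy_commute[OF C2 S z] by (simp add: algebra_simps)
    then show ?thesis
      using has_field_derivative_if_Cauchy_Riemann[OF differentiableI[OF W]]
      by (auto simp: field_differentiable_def)
  qed
  then show ?thesis using S by (simp add: holomorphic_on_open field_differentiable_def)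
qed

text \<open>Convexity provides a holomorphic primitive \<open>h\<close> of \<open>wirtinger_dz f\<close>. What is left, \<open>f - h\<close>, has
  vanishing \<open>z\<close>-derivative and is therefore the conjugate of a holomorphic function.\<close>
lemma harmonic_on_convex_decomposition:
  assumes f: "harmonic_on f S" and S: "convex S"
  obtains h g where "h holomorphic_on S" "g holomorphic_on S" "\<And>z. z \<in> S \<Longrightarrow> f z = h z + cnj (g z)"
proof -
  have op: "open S" and C2: "C2_on f S" using f by (auto simp: harmonic_on_def)
  obtain h where h: "\<And>z. z \<in> S \<Longrightarrow> (h has_field_derivative wirtinger_dz f z) (at z within S)"
    using holomorphic_convex_primitive'[OF S op harmonic_on_imp_holomorphic_dz[OF f]] by blast
  have h': "(h has_field_derivative wirtinger_dz f z) (at z)" if "z \<in> S" for z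
    using h[OF that] at_within_open[OF that op] by simp
  define g where "g = (\<lambda>z. cnj (f z - h z))"
  have "g field_differentiable (at z)" if z: "z \<in> S" for z
  proof -
    have "(f has_derivative frechet_derivative f (at z)) (at z)"
      using C2 z by (auto simp: C2_on_def C1_on_def simp flip: frechet_derivative_works)
    moreover have "(h has_derivative (*) (wirtinger_dz f z)) (at z)"
      using h'[OF z] by (simp add: has_field_derivative_def)
    ultimately have G: "(g has_derivative (\<lambda>w. cnj (frechet_derivative f (at z) w - wirtinger_dz f z * w))) (at z)"
      unfolding g_def
      by (intro bounded_linear.has_derivative[OF bounded_linear_cnj] has_derivative_diff)
    have "dy g z = \<i> * dx g z"
      unfolding has_derivative_imp_dx_dy[OF G] by (simp add: wirtinger_dz_def dx_def dy_def field_simps)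
    then show ?thesis
      using has_field_derivative_if_Cauchy_Riemann[OF differentiableI[OF G]]
      by (auto simp: field_differentiable_def)
  qed
  then have "g holomorphic_on S"
    using op by (simp add: holomorphic_on_open field_differentiable_def)
  moreover have "h holomorphic_on S"
    using op h' by (auto simp: holomorphic_on_open)
  ultimately show ?thesis
    using that[of h g] by (simp add: g_def)
qed

section \<open>Wirtinger derivatives of \<open>h + cnj g\<close>\<close>

text \<open>The functions \<open>h + cnj g\<close> are closed under both partial derivatives, with \<open>(h, g)\<close> becoming
  \<open>(h', g')\<close> and \<open>(\<i> h', \<i> g')\<close>. The hypothesis speaks of values on \<open>S\<close> only, so that the lemma can be
  applied again to \<open>dx f\<close> and \<open>dy f\<close>.\<close>
lemma dx_dy_holomorphic_add_cnj:
  assumes S: "open S" "z \<in> S" and h: "h holomorphic_on S" and g: "g holomorphic_on S"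
    and eq: "\<And>w. w \<in> S \<Longrightarrow> f w = h w + cnj (g w)"
  shows "f differentiable (at z)" "dx f z = deriv h z + cnj (deriv g z)"
    "dy f z = \<i> * deriv h z + cnj (\<i> * deriv g z)"
proof -
  have "(h has_derivative (*) (deriv h z)) (at z)" "(g has_derivative (*) (deriv g z)) (at z)"
    using holomorphic_derivI[OF h S] holomorphic_derivI[OF g S] by (auto simp: has_field_derivative_def)
  then have "((\<lambda>w. h w + cnj (g w)) has_derivative (\<lambda>w. deriv h z * w + cnj (deriv g z * w))) (at z)"
    by (intro has_derivative_add bounded_linear.has_derivative[OF bounded_linear_cnj])
  then have D: "(f has_derivative (\<lambda>w. deriv h z * w + cnj (deriv g z * w))) (at z)"
    by (rule has_derivative_transform_within_open[OF _ S]) (simp add: eq)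
  then show "f differentiable (at z)" by (rule differentiableI)
  show "dx f z = deriv h z + cnj (deriv g z)" "dy f z = \<i> * deriv h z + cnj (\<i> * deriv g z)"
    using has_derivative_imp_dx_dy[OF D] by (simp_all add: mult.commute)
qed

lemma C1_on_holomorphic_add_cnj:
  assumes S: "open S" and h: "h holomorphic_on S" and g: "g holomorphic_on S"
    and eq: "\<And>w. w \<in> S \<Longrightarrow> f w = h w + cnj (g w)"
  shows "C1_on f S"
proof -
  note D = dx_dy_holomorphic_add_cnj[OF S _ h g eq]
  have "continuous_on S (deriv h)" "continuous_on S (deriv g)"
    using h g S holomorphic_deriv holomorphic_on_imp_continuous_on by blast+
  then have "continuous_on S (\<lambda>z. deriv h z + cnj (deriv g z))"
    "continuous_on S (\<lambda>z. \<i> * deriv h z + cnj (\<i> * deriv g z))"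
    by (auto intro!: continuous_intros)
  then show ?thesis
    unfolding C1_on_def using D by (auto cong: continuous_on_cong)
qed

lemma harmonic_on_holomorphic_add_cnj:
  assumes S: "open S" and h: "h holomorphic_on S" and g: "g holomorphic_on S"
  shows "harmonic_on (\<lambda>z. h z + cnj (g z)) S"
proof -
  define f where "f = (\<lambda>z. h z + cnj (g z))"
  have h': "deriv h holomorphic_on S" "(\<lambda>z. \<i> * deriv h z) holomorphic_on S"
    and g': "deriv g holomorphic_on S" "(\<lambda>z. \<i> * deriv g z) holomorphic_on S"
    using S h g by (auto intro!: holomorphic_intros)
  have X: "dx f z = deriv h z + cnj (deriv g z)"
    and Y: "dy f z = \<i> * deriv h z + cnj (\<i> * deriv g z)" if "z \<in> S" for z
    using dx_dy_holomorphic_add_cnj[OF S that h g] by (simp_all add: f_def)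
  have "dx (dx f) z + dy (dy f) z = 0" if z: "z \<in> S" for z
  proof -
    have "deriv (\<lambda>z. \<i> * deriv h z) z = \<i> * deriv (deriv h) z"
      "deriv (\<lambda>z. \<i> * deriv g z) z = \<i> * deriv (deriv g) z"
      using h'(1) g'(1) S z by (auto intro!: deriv_cmult simp: holomorphic_on_imp_differentiable_at)
    then show ?thesis
      using dx_dy_holomorphic_add_cnj(2)[OF S z h'(1) g'(1) X]
        dx_dy_holomorphic_add_cnj(3)[OF S z h'(2) g'(2) Y]
      by (simp add: mult.assoc[symmetric])
  qed
  moreover have "C2_on f S"
    unfolding C2_on_def
    using C1_on_holomorphic_add_cnj[OF S h g] C1_on_holomorphic_add_cnj[OF S h'(1) g'(1) X]
      C1_on_holomorphic_add_cnj[OF S h'(2) g'(2) Y] by (simp add: f_def)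
  ultimately show ?thesis using S by (simp add: harmonic_on_def f_def)
qed

lemma wirtinger_holomorphic_add_cnj:
  assumes S: "open S" "z \<in> S" and h: "h holomorphic_on S" and g: "g holomorphic_on S"
    and eq: "\<And>w. w \<in> S \<Longrightarrow> f w = h w + cnj (g w)"
  shows "wirtinger_dz f z = deriv h z" "wirtinger_dzbar f z = cnj (deriv g z)"
proof -
  have X: "dx f z = deriv h z + cnj (deriv g z)"
    by (rule dx_dy_holomorphic_add_cnj(2)[OF S h g eq])
  have Y: "dy f z = \<i> * deriv h z + cnj (\<i> * deriv g z)"
    by (rule dx_dy_holomorphic_add_cnj(3)[OF S h g eq])
  show "wirtinger_dz f z = deriv h z" "wirtinger_dzbar f z = cnj (deriv g z)"
    unfolding wirtinger_dz_def wirtinger_dzbar_def X Y by (simp_all add: algebra_simps)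
qed

text \<open>The first derivative already removes one of the two parts; from then on the other part is \<open>0\<close>.
  This is why the order has to be at least one.\<close>
lemma higher_wirtinger_holomorphic_add_cnj:
  assumes S: "open S" and h: "h holomorphic_on S" and g: "g holomorphic_on S"
    and eq: "\<And>w. w \<in> S \<Longrightarrow> f w = h w + cnj (g w)" and z: "z \<in> S"
  shows "(wirtinger_dz ^^ Suc n) f z = (deriv ^^ Suc n) h z"
    "(wirtinger_dzbar ^^ Suc n) f z = cnj ((deriv ^^ Suc n) g z)"
proof -
  have "\<forall>z\<in>S. (wirtinger_dz ^^ Suc n) f z = (deriv ^^ Suc n) h z \<and>
     (wirtinger_dzbar ^^ Suc n) f z = cnj ((deriv ^^ Suc n) g z)"
  proof (induction n)
    case 0
    then show ?case using wirtinger_holomorphic_add_cnj[OF S _ h g eq] by simp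
  next
    case (Suc n)
    have hol: "(deriv ^^ Suc n) h holomorphic_on S" "(deriv ^^ Suc n) g holomorphic_on S"
      using S h g holomorphic_higher_deriv by blast+
    show ?case
    proof
      fix z assume z: "z \<in> S"
      have "wirtinger_dz ((wirtinger_dz ^^ Suc n) f) z = deriv ((deriv ^^ Suc n) h) z"
        by (rule wirtinger_holomorphic_add_cnj(1)[OF S z hol(1) holomorphic_on_const[of 0]])
          (use Suc in simp)
      moreover have "wirtinger_dzbar ((wirtinger_dzbar ^^ Suc n) f) z = cnj (deriv ((deriv ^^ Suc n) g) z)"
        by (rule wirtinger_holomorphic_add_cnj(2)[OF S z holomorphic_on_const[of 0] hol(2)])
          (use Suc in simp)
      ultimately show "(wirtinger_dz ^^ Suc (Suc n)) f z = (deriv ^^ Suc (Suc n)) h z \<and>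
         (wirtinger_dzbar ^^ Suc (Suc n)) f z = cnj ((deriv ^^ Suc (Suc n)) g z)"
        by simp
    qed
  qed
  then show "(wirtinger_dz ^^ Suc n) f z = (deriv ^^ Suc n) h z"
    "(wirtinger_dzbar ^^ Suc n) f z = cnj ((deriv ^^ Suc n) g z)"
    using z by auto
qed

section \<open>Mean values on the unit circle\<close>

text \<open>Cauchy's formula for derivatives, with the unit circle parametrised proportionally to arc length and total
  mass one, so that integrals over \<open>{0..1}\<close> are mean values.\<close>
lemma Cauchy_has_integral_unit_circle:
  assumes "continuous_on (cball 0 1) h" "h holomorphic_on ball 0 1" "z \<in> ball 0 1"
  shows "((\<lambda>t. h (cis (2*pi*t)) * cis (2*pi*t) / (cis (2*pi*t) - z) ^ Suc n)
            has_integral ((deriv ^^ n) h z / fact n)) {0..1}"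
proof -
  have "((\<lambda>u. h u / (u-z) ^ (Suc n)) has_contour_integral
          ((2 * pi * \<i>) / (fact n) * (deriv ^^ n) h z)) (circlepath 0 1)"
    by (rule Cauchy_has_contour_integral_higher_derivative_circlepath[OF assms])
  then have "((\<lambda>t. h (circlepath 0 1 t) / (circlepath 0 1 t - z) ^ Suc n *
          vector_derivative (circlepath 0 1) (at t within {0..1})) has_integral
          ((2 * pi * \<i>) / (fact n) * (deriv ^^ n) h z)) {0..1}"
    by (simp add: has_contour_integral_def)
  moreover have "h (circlepath 0 1 t) / (circlepath 0 1 t - z) ^ Suc n *
          vector_derivative (circlepath 0 1) (at t within {0..1}) =
        (2 * pi * \<i>) * (h (cis (2*pi*t)) * cis (2*pi*t) / (cis (2*pi*t) - z) ^ Suc n)"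
    if "t \<in> {0..1}" for t
  proof -
    have "circlepath 0 1 t = cis (2*pi*t)"
      by (simp add: circlepath cis_conv_exp mult_ac)
    moreover have "vector_derivative (circlepath 0 1) (at t within {0..1}) = 2 * pi * \<i> * cis (2*pi*t)"
      using that by (simp add: vector_derivative_circlepath01 cis_conv_exp mult_ac)
    ultimately show ?thesis by (simp only: times_divide_eq_right times_divide_eq_left mult_ac)
  qed
  ultimately have "((\<lambda>t. (2 * pi * \<i>) * (h (cis (2*pi*t)) * cis (2*pi*t) / (cis (2*pi*t) - z) ^ Suc n))
      has_integral ((2 * pi * \<i>) / (fact n) * (deriv ^^ n) h z)) {0..1}"
    by (simp only: cong: has_integral_cong)
  from has_integral_mult_right[OF this, of "inverse (2 * pi * \<i>)"] show ?thesis
    by (simp add: field_simps)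
qed

lemma has_integral_norm_le:
  fixes f :: "'n::euclidean_space \<Rightarrow> 'a::banach" and g :: "'n \<Rightarrow> real"
  assumes "(f has_integral i) S" "(g has_integral j) S" "\<And>x. x \<in> S \<Longrightarrow> norm (f x) \<le> g x"
  shows "norm i \<le> j"
  using integral_norm_bound_integral[of f S g] assms
  by (auto simp: has_integral_iff)

text \<open>Expanding \<open>(\<phi> + cnj \<phi>) ^ m\<close> leaves only powers of \<open>\<phi>\<close> and of \<open>cnj \<phi>\<close>, since the two are inverse to
  each other, and all but the constant term integrate to \<open>0\<close>. The result does not depend on \<open>w\<close> and
  \<open>\<phi>\<close>, and that is its use: two such pairs have the same moments.\<close>
lemma has_integral_mult_Re_power:
  fixes \<phi> :: "real \<Rightarrow> complex" and w :: "real \<Rightarrow> real"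
  assumes unit: "\<And>t. t \<in> {0..1} \<Longrightarrow> cmod (\<phi> t) = 1"
    and moments: "\<And>k. ((\<lambda>t. of_real (w t) * \<phi> t ^ k) has_integral 0 ^ k) {0..1}"
  shows "((\<lambda>t. w t * Re (\<phi> t) ^ m) has_integral
           (\<Sum>j\<le>m. if 2 * j = m then real (m choose j) / 2 ^ m else 0)) {0..1}"
proof -
  have inv: "\<phi> t * cnj (\<phi> t) = 1" if "t \<in> {0..1}" for t
    using unit[OF that] by (metis complex_norm_square of_real_1 one_power2)
  have summand: "((\<lambda>t. of_real (w t) * (\<phi> t ^ j * cnj (\<phi> t) ^ (m - j)))
          has_integral (if 2 * j = m then 1 else 0)) {0..1}" if "j \<le> m" for j
  proof (cases "2 * j \<ge> m")
    case True
    have "\<phi> t ^ j * cnj (\<phi> t) ^ (m - j) = \<phi> t ^ (2 * j - m)" if "t \<in> {0..1}" for t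
    proof -
      have "j = (2 * j - m) + (m - j)" using True \<open>j \<le> m\<close> by simp
      then have "\<phi> t ^ j = \<phi> t ^ (2 * j - m) * \<phi> t ^ (m - j)"
        by (metis power_add)
      then have "\<phi> t ^ j * cnj (\<phi> t) ^ (m - j) = \<phi> t ^ (2 * j - m) * (\<phi> t * cnj (\<phi> t)) ^ (m - j)"
        by (simp only: power_mult_distrib mult.assoc)
      then show ?thesis using inv[OF that] by simp
    qed
    then show ?thesis using moments[of "2 * j - m"] True
      by (subst has_integral_cong) (auto simp: power_0_left)
  next
    case False
    have "\<phi> t ^ j * cnj (\<phi> t) ^ (m - j) = cnj (\<phi> t) ^ (m - 2 * j)" if "t \<in> {0..1}" for t
    proof -
      have "m - j = (m - 2 * j) + j" using False by simp
      then have "cnj (\<phi> t) ^ (m - j) = cnj (\<phi> t) ^ (m - 2 * j) * cnj (\<phi> t) ^ j"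
        by (metis power_add)
      then have "\<phi> t ^ j * cnj (\<phi> t) ^ (m - j) = cnj (\<phi> t) ^ (m - 2 * j) * (\<phi> t * cnj (\<phi> t)) ^ j"
        by (simp only: power_mult_distrib mult_ac)
      then show ?thesis using inv[OF that] by simp
    qed
    moreover have "((\<lambda>t. of_real (w t) * cnj (\<phi> t) ^ (m - 2 * j)) has_integral 0) {0..1}"
      using moments[of "m - 2 * j"] False
        has_integral_cnj[of "\<lambda>t. of_real (w t) * \<phi> t ^ (m - 2 * j)" 0 "{0..1}"]
      by (simp add: comp_def power_0_left)
    ultimately show ?thesis using False
      by (subst has_integral_cong) auto
  qed
  have "((\<lambda>t. \<Sum>j\<le>m. of_nat (m choose j) / 2 ^ m *
                (of_real (w t) * (\<phi> t ^ j * cnj (\<phi> t) ^ (m - j))))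
     has_integral (\<Sum>j\<le>m. of_nat (m choose j) / 2 ^ m * (if 2 * j = m then 1 else 0))) {0..1}"
    by (intro has_integral_sum has_integral_mult_right summand) auto
  also have "(\<lambda>t. \<Sum>j\<le>m. of_nat (m choose j) / 2 ^ m *
                (of_real (w t) * (\<phi> t ^ j * cnj (\<phi> t) ^ (m - j))))
        = (\<lambda>t. of_real (w t * Re (\<phi> t) ^ m))"
  proof
    fix t
    have "complex_of_real (Re (\<phi> t)) = (\<phi> t + cnj (\<phi> t)) / 2"
      by (simp add: complex_add_cnj)
    then have "complex_of_real (Re (\<phi> t) ^ m) = (\<phi> t + cnj (\<phi> t)) ^ m / 2 ^ m"
      by (simp only: of_real_power power_divide)
    then show "(\<Sum>j\<le>m. of_nat (m choose j) / 2 ^ m *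
                (of_real (w t) * (\<phi> t ^ j * cnj (\<phi> t) ^ (m - j)))) = of_real (w t * Re (\<phi> t) ^ m)"
      by (simp add: binomial_ring sum_divide_distrib sum_distrib_left mult_ac)
  qed
  finally have "(Re \<circ> (\<lambda>t. of_real (w t * Re (\<phi> t) ^ m)) has_integral
       Re (\<Sum>j\<le>m. of_nat (m choose j) / 2 ^ m * (if 2 * j = m then 1 else 0))) {0..1}"
    by (rule has_integral_linear[OF _ bounded_linear_Re])
  also have "Re \<circ> (\<lambda>t. of_real (w t * Re (\<phi> t) ^ m)) = (\<lambda>t. w t * Re (\<phi> t) ^ m)"
    by (simp only: comp_def Re_complex_of_real)
  also have "Re (\<Sum>j\<le>m. of_nat (m choose j) / 2 ^ m * (if 2 * j = m then 1 else 0)) =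
      (\<Sum>j\<le>m. Re (complex_of_real (if 2 * j = m then real (m choose j) / 2 ^ m else 0)))"
    unfolding Re_sum by (rule sum.cong) auto
  finally show ?thesis by (simp only: Re_complex_of_real)
qed

lemma has_integral_cis_power:
  "((\<lambda>t. cis (2*pi*t) ^ k) has_integral 0 ^ k) {0..1}"
proof -
  have "((\<lambda>t. cis (2*pi*t) ^ k * cis (2*pi*t) / (cis (2*pi*t) - 0) ^ Suc 0)
      has_integral (deriv ^^ 0) (\<lambda>u. u ^ k) 0 / fact 0) {0..1}"
    by (intro Cauchy_has_integral_unit_circle continuous_intros holomorphic_intros) auto
  then show ?thesis by simp
qed

text \<open>If all moments of \<open>\<phi>\<close> of positive order with respect to the density \<open>w\<close> vanish, then \<open>\<phi>\<close> is uniformly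
  distributed on the unit circle: integrals of polynomials in \<open>Re \<phi>\<close> agree with those for the
  rotation \<open>cis (2*pi*t)\<close>, and polynomials are uniformly dense.\<close>
lemma integral_mult_comp_Re:
  fixes \<phi> :: "real \<Rightarrow> complex" and w F :: "real \<Rightarrow> real"
  assumes cont: "continuous_on {0..1} \<phi>" "continuous_on {0..1} w"
    and unit: "\<And>t. t \<in> {0..1} \<Longrightarrow> cmod (\<phi> t) = 1"
    and nonneg: "\<And>t. t \<in> {0..1} \<Longrightarrow> w t \<ge> 0"
    and moments: "\<And>k. ((\<lambda>t. of_real (w t) * \<phi> t ^ k) has_integral 0 ^ k) {0..1}"
    and F: "continuous_on {-1..1} F"
  shows "integral {0..1} (\<lambda>t. w t * F (Re (\<phi> t))) = integral {0..1} (\<lambda>t. F (cos (2*pi*t)))"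
    (is "?I = ?J")
proof -
  have Re_in: "Re (\<phi> t) \<in> {-1..1}" if "t \<in> {0..1}" for t
    using abs_Re_le_cmod[of "\<phi> t"] unit[OF that] by auto
  have "(w has_integral 1) {0..1}"
    using has_integral_mult_Re_power[OF unit moments, of 0] by simp
  have int_L: "(\<lambda>t. w t * F (Re (\<phi> t))) integrable_on {0..1}"
    using Re_in by (intro integrable_continuous_real continuous_intros cont
        continuous_on_compose2[OF F]) auto
  have int_R: "(\<lambda>t. F (cos (2*pi*t))) integrable_on {0..1}"
    by (intro integrable_continuous_real continuous_on_compose2[OF F] continuous_intros) auto
  have approx: "\<bar>?I - ?J\<bar> \<le> e + e" if "e > 0" for e
  proof -
    obtain g where g: "real_polynomial_function g"
      and close: "\<And>x. x \<in> {-1..1} \<Longrightarrow> \<bar>F x - g x\<bar> < e"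
      using Stone_Weierstrass_real_polynomial_function[OF compact_Icc F \<open>e > 0\<close>] by blast
    obtain a N where g_eq: "g = (\<lambda>x. \<Sum>i\<le>N. a i * x ^ i)"
      using g real_polynomial_function_iff_sum by blast
    define G where "G = (\<Sum>i\<le>N. a i * (\<Sum>j\<le>i. if 2 * j = i then real (i choose j) / 2 ^ i else 0))"
    have "((\<lambda>t. \<Sum>i\<le>N. a i * (w t * Re (\<phi> t) ^ i)) has_integral G) {0..1}"
      unfolding G_def
      by (intro has_integral_sum has_integral_mult_right has_integral_mult_Re_power unit moments) auto
    then have gL: "((\<lambda>t. w t * g (Re (\<phi> t))) has_integral G) {0..1}"
      by (simp add: g_eq sum_distrib_left mult_ac)
    have "((\<lambda>t. 1 * Re (cis (2*pi*t)) ^ i) has_integral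
       (\<Sum>j\<le>i. if 2 * j = i then real (i choose j) / 2 ^ i else 0)) {0..1}" for i
      using has_integral_cis_power by (intro has_integral_mult_Re_power) auto
    then have "((\<lambda>t. \<Sum>i\<le>N. a i * (1 * Re (cis (2*pi*t)) ^ i)) has_integral G) {0..1}"
      unfolding G_def
      by (intro has_integral_sum has_integral_mult_right) auto
    then have gR: "((\<lambda>t. g (cos (2*pi*t))) has_integral G) {0..1}"
      by (simp add: g_eq)
    have "((\<lambda>t. w t * F (Re (\<phi> t)) - w t * g (Re (\<phi> t))) has_integral ?I - G) {0..1}"
      using gL int_L by (intro has_integral_diff integrable_integral)
    then have L: "norm (?I - G) \<le> 1 * e"
    proof (rule has_integral_norm_le)
      show "((\<lambda>t. w t * e) has_integral 1 * e) {0..1}"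
        by (rule has_integral_mult_left) fact
      show "norm (w t * F (Re (\<phi> t)) - w t * g (Re (\<phi> t))) \<le> w t * e" if "t \<in> {0..1}" for t
        using close[OF Re_in[OF that]] nonneg[OF that]
        by (simp add: abs_mult mult_left_mono flip: right_diff_distrib)
    qed
    have "((\<lambda>t. F (cos (2*pi*t)) - g (cos (2*pi*t))) has_integral ?J - G) {0..1}"
      using gR int_R by (intro has_integral_diff integrable_integral)
    then have R: "norm (?J - G) \<le> e"
    proof (rule has_integral_norm_le)
      show "((\<lambda>t. e) has_integral e) {0..1::real}"
        using has_integral_const_real[of e 0 1] by simp
      show "norm (F (cos (2*pi*t)) - g (cos (2*pi*t))) \<le> e" for t
        using close[of "cos (2*pi*t)"] by simp
    qed
    from L R show ?thesis by simp
  qed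
  have "\<bar>?I - ?J\<bar> \<le> 0"
  proof (rule field_le_epsilon)
    show "\<bar>?I - ?J\<bar> \<le> 0 + e" if "e > 0" for e
      using approx[of "e / 2"] that by simp
  qed
  then show ?thesis by simp
qed

text \<open>The integrand is \<open>\<bar>cos (pi*t)\<bar>\<close>; its mean value is the source of the factor \<open>4 / pi\<close> in the final estimate.\<close>
lemma has_integral_sqrt_half_one_plus_cos:
  "((\<lambda>t. sqrt ((1 + cos (2*pi*t)) / 2)) has_integral 2 / pi) {0..1}"
proof -
  have eq: "sqrt ((1 + cos (2*pi*t)) / 2) = \<bar>cos (pi*t)\<bar>" for t :: real
  proof -
    have "(1 + cos (2*(pi*t))) / 2 = cos (pi*t) ^ 2"
      by (subst cos_double_cos) simp
    then show ?thesis by (metis mult.assoc real_sqrt_abs)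
  qed
  have deriv: "((\<lambda>t. sin (pi*t) / pi) has_vector_derivative cos (pi*t)) (at t within S)" for t S
    by (auto simp flip: has_real_derivative_iff_has_vector_derivative
             intro!: derivative_eq_intros)
  have "((\<lambda>t. cos (pi*t)) has_integral (sin (pi*(1/2)) / pi - sin (pi*0) / pi)) {0..1/2}"
    by (intro fundamental_theorem_of_calculus deriv) auto
  moreover have "\<bar>cos (pi*t)\<bar> = cos (pi*t)" if "t \<in> {0..1/2}" for t
  proof -
    have "pi * t \<le> pi * (1/2)" using that by (intro mult_left_mono) auto
    then show ?thesis using that by (intro abs_of_nonneg cos_ge_zero) (auto intro: order_trans[of _ 0])
  qed
  ultimately have 1: "((\<lambda>t. \<bar>cos (pi*t)\<bar>) has_integral 1 / pi) {0..1/2}"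
    by (subst has_integral_cong[of _ _ "\<lambda>t. cos (pi*t)"]) auto
  have "((\<lambda>t. - cos (pi*t)) has_integral - (sin (pi*1) / pi - sin (pi*(1/2)) / pi)) {1/2..1}"
    by (intro has_integral_neg fundamental_theorem_of_calculus deriv) auto
  moreover have "\<bar>cos (pi*t)\<bar> = - cos (pi*t)" if "t \<in> {1/2..1}" for t
  proof -
    have "pi * (1/2) \<le> pi * t" "pi * t \<le> pi * 1" using that by (intro mult_left_mono; simp)+
    then have "cos (pi * t) \<le> cos (pi * (1/2))" by (intro cos_monotone_0_pi_le) auto
    then show ?thesis by simp
  qed
  ultimately have 2: "((\<lambda>t. \<bar>cos (pi*t)\<bar>) has_integral 1 / pi) {1/2..1}"
    by (subst has_integral_cong[of _ _ "\<lambda>t. - cos (pi*t)"]) auto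
  show ?thesis unfolding eq
    using has_integral_combine[OF _ _ 1 2] by simp
qed

section \<open>The mean value of the real part of the kernel\<close>

text \<open>If \<open>v\<close> has argument \<open>\<theta>\<close> then \<open>cnj v / v\<close> has argument \<open>- 2 * \<theta>\<close>, and
  \<open>\<bar>cos \<theta>\<bar> = sqrt ((1 + cos (2 * \<theta>)) / 2)\<close>. The direction of \<open>v\<close> then enters
  only through \<open>cnj v / v\<close>, which for the kernels considered below is the boundary value of a holomorphic function.\<close>
lemma abs_Re_eq_norm_mult_sqrt:
  assumes "v \<noteq> 0"
  shows "\<bar>Re v\<bar> = cmod v * sqrt ((1 + Re (cnj v / v)) / 2)"
proof -
  have Im_sq: "Im v ^ 2 = cmod v ^ 2 - Re v ^ 2" by (simp add: cmod_power2)
  have "Re (cnj v / v) = (Re v ^ 2 - Im v ^ 2) / cmod v ^ 2"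
    by (simp add: Re_divide cmod_power2) (simp add: power2_eq_square)
  then have "(1 + Re (cnj v / v)) / 2 = (Re v / cmod v) ^ 2"
    using assms by (simp add: Im_sq power_divide diff_divide_distrib)
  then have "sqrt ((1 + Re (cnj v / v)) / 2) = \<bar>Re v\<bar> / cmod v"
    by (simp add: abs_divide)
  then show ?thesis using assms by simp
qed

lemma one_minus_cnj_mult_nonzero:
  assumes "cmod z < 1" "cmod u \<le> 1"
  shows "1 - cnj z * u \<noteq> 0"
proof
  assume "1 - cnj z * u = 0"
  then have "cmod (cnj z * u) = 1" by (metis eq_iff_diff_eq_0 norm_one)
  moreover have "cmod (cnj z * u) < 1"
    using assms mult_left_le[of "cmod u" "cmod z"] by (simp add: norm_mult)
  ultimately show False by simp
qed

text \<open>The heart of the estimate. Write \<open>v\<close> for the kernel times \<open>c\<close>. On the unit circle \<open>cnj v / v\<close> coincides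
  with \<open>B\<close>, a unimodular constant times the Blaschke product
  \<open>u ^ m * ((u - z) / (1 - cnj z * u)) ^ (m + 2)\<close>, and \<open>\<bar>v\<bar>\<close> is at most the constant \<open>C\<close> of the claim times the
  Poisson kernel \<open>w\<close> of the point \<open>z\<close>. The Poisson integral of \<open>B ^ k\<close> is \<open>B z ^ k = 0 ^ k\<close>. Hence
  \<open>B\<close> is uniformly distributed with respect to \<open>w\<close>, and the integral of
  \<open>w * sqrt ((1 + Re B) / 2)\<close> equals \<open>2 / pi\<close> whatever \<open>z\<close>, \<open>c\<close> and \<open>m\<close> are.\<close>
lemma integral_abs_Re_Cauchy_kernel_le:
  assumes z: "cmod z < 1" and c: "cmod c = 1"
  shows "integral {0..1} (\<lambda>t. \<bar>Re (c * (cis (2*pi*t) / (cis (2*pi*t) - z) ^ Suc (Suc m)))\<bar>)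
           \<le> 2 / pi * (1 / ((1 - cmod z) ^ Suc m * (1 + cmod z)))"
proof -
  define e where "e = (\<lambda>t. cis (2*pi*t))"
  define B where "B = (\<lambda>u. cnj c ^ 2 * u ^ m * ((u - z) / (1 - cnj z * u)) ^ Suc (Suc m))"
  define w where "w = (\<lambda>t. (1 - cmod z ^ 2) / cmod (e t - z) ^ 2)"
  define v where "v = (\<lambda>t. c * (e t / (e t - z) ^ Suc (Suc m)))"
  define F where "F = (\<lambda>x::real. sqrt ((1 + x) / 2))"
  define C where "C = 1 / ((1 - cmod z) ^ Suc m * (1 + cmod z))"
  have c0: "c \<noteq> 0" using c by auto
  have cc: "cnj c / c = cnj c ^ 2"
  proof -
    have "c * cnj c = 1" using c by (metis complex_norm_square of_real_1 one_power2)
    then show ?thesis using c0 by (simp add: field_simps power2_eq_square)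
  qed
  have norm_e [simp]: "cmod (e t) = 1" for t by (simp add: e_def)
  have e0 [simp]: "e t \<noteq> 0" for t by (simp add: e_def)
  have cnj_e: "cnj (e t) = 1 / e t" for t
    by (simp add: e_def cis_cnj divide_inverse)
  have cont_e: "continuous_on S e" for S
    unfolding e_def by (intro continuous_intros)
  have ez [simp]: "e t - z \<noteq> 0" for t
    using norm_e[of t] z by (metis eq_iff_diff_eq_0 less_irrefl)
  have e_neq [simp]: "e t \<noteq> z" for t using ez[of t] by auto
  note den = one_minus_cnj_mult_nonzero[OF z]
  have cnj_diff: "cnj (e t - z) = (1 - cnj z * e t) / e t" for t
    by (simp add: cnj_e field_simps)
  have v0: "v t \<noteq> 0" for t using c0 by (simp add: v_def)
  \<comment> \<open>The square of \<open>cnj c\<close> in \<open>B\<close> arises here, as \<open>cnj c / c\<close> for unimodular \<open>c\<close>.\<close>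
  have B_eq: "B (e t) = cnj (v t) / v t" for t
  proof -
    have "cnj (v t) = cnj c * (1 / e t / ((1 - cnj z * e t) / e t) ^ Suc (Suc m))"
      by (simp only: v_def complex_cnj_mult complex_cnj_divide complex_cnj_power cnj_diff cnj_e)
    also have "\<dots> = cnj c * (e t ^ Suc m / (1 - cnj z * e t) ^ Suc (Suc m))"
      by (simp add: power_divide)
    finally have "cnj (v t) / v t = (cnj c / c) *
        (e t ^ Suc m / e t * ((e t - z) ^ Suc (Suc m) / (1 - cnj z * e t) ^ Suc (Suc m)))"
      using c0 by (simp add: v_def mult_ac del: power_Suc)
    also have "\<dots> = B (e t)"
      unfolding B_def cc power_divide by (simp del: power_Suc add: power_Suc[of "e t" m])
    finally show ?thesis ..
  qed
  have normB: "cmod (B (e t)) = 1" for t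
    using v0 by (simp add: B_eq norm_divide)
  \<comment> \<open>On the circle the Poisson kernel is the Cauchy kernel times a function holomorphic near the closed disc.\<close>
  have w_eq: "of_real (w t) = (1 - cnj z * z) * e t / ((e t - z) * (1 - cnj z * e t))" for t
  proof -
    have "complex_of_real (cmod (e t - z) ^ 2) = (e t - z) * ((1 - cnj z * e t) / e t)"
      by (simp only: complex_norm_square cnj_diff)
    moreover have "complex_of_real (1 - cmod z ^ 2) = 1 - cnj z * z"
      by (simp only: of_real_diff complex_norm_square of_real_1 mult.commute)
    ultimately show ?thesis
      by (simp add: w_def)
  qed
  have w_nonneg: "w t \<ge> 0" for t
    unfolding w_def using z by (intro divide_nonneg_nonneg) (auto simp: power_le_one)
  have cont_w: "continuous_on {0..1} w"
    unfolding w_def by (intro continuous_intros cont_e) auto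
  have den': "1 - cnj z * e t \<noteq> 0" for t by (rule den) simp
  have cont_B: "continuous_on {0..1} (\<lambda>t. B (e t))"
    unfolding B_def by (intro continuous_intros cont_e ballI den')
  have moments: "((\<lambda>t. of_real (w t) * B (e t) ^ k) has_integral 0 ^ k) {0..1}" for k
  proof -
    \<comment> \<open>With \<open>w_eq\<close>, the Poisson integral of \<open>B ^ k\<close> becomes a Cauchy integral of this \<open>h\<close>.\<close>
    define h where "h = (\<lambda>u. B u ^ k * (1 - cnj z * z) / (1 - cnj z * u))"
    have "((\<lambda>t. h (e t) * e t / (e t - z) ^ Suc 0) has_integral (deriv ^^ 0) h z / fact 0) {0..1}"
      unfolding e_def
    proof (rule Cauchy_has_integral_unit_circle)
      show "continuous_on (cball 0 1) h"
        unfolding h_def B_def using den by (intro continuous_intros) auto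
      show "h holomorphic_on ball 0 1"
        unfolding h_def B_def using den by (intro holomorphic_intros) auto
    qed (use z in simp)
    moreover have "h z = 0 ^ k"
      using den[of z] z by (cases k) (auto simp: h_def B_def)
    moreover have "h (e t) * e t / (e t - z) ^ Suc 0 = of_real (w t) * B (e t) ^ k" for t
      by (simp add: h_def w_eq mult_ac)
    ultimately show ?thesis by simp
  qed
  have F_int: "integral {0..1} (\<lambda>t. w t * F (Re (B (e t)))) = 2 / pi"
  proof -
    have "integral {0..1} (\<lambda>t. w t * F (Re (B (e t)))) = integral {0..1} (\<lambda>t. F (cos (2*pi*t)))"
      using cont_B cont_w normB w_nonneg moments
      by (intro integral_mult_comp_Re) (auto simp: F_def intro!: continuous_intros)
    then show ?thesis
      using has_integral_sqrt_half_one_plus_cos by (simp add: F_def integral_unique)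
  qed
  have pointwise: "\<bar>Re (v t)\<bar> \<le> C * (w t * F (Re (B (e t))))" for t
  proof -
    have F0: "F (Re (B (e t))) \<ge> 0"
      using abs_Re_le_cmod[of "B (e t)"] normB[of t] by (simp add: F_def)
    \<comment> \<open>All but two of the factors \<open>1 / \<bar>e t - z\<bar>\<close> are estimated trivially; the last two form the Poisson kernel.\<close>
    have "1 - cmod z \<le> cmod (e t - z)"
      using norm_triangle_ineq2[of "e t" z] by simp
    then have pow: "(1 - cmod z) ^ m \<le> cmod (e t - z) ^ m"
      using z by (intro power_mono) auto
    have "cmod (v t) = 1 / cmod (e t - z) ^ m / cmod (e t - z) ^ 2"
      using c by (simp add: v_def norm_mult norm_divide norm_power power2_eq_square mult_ac)
    also have "\<dots> \<le> 1 / (1 - cmod z) ^ m / cmod (e t - z) ^ 2"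
      using pow z by (intro divide_right_mono divide_left_mono) (auto intro!: mult_pos_pos)
    also have "\<dots> = C * w t"
    proof -
      have "1 - cmod z ^ 2 = (1 - cmod z) * (1 + cmod z)"
        by (simp add: algebra_simps power2_eq_square)
      moreover have "1 - cmod z > 0" "1 + cmod z > 0" using z by (auto intro: add_pos_nonneg)
      ultimately show ?thesis by (simp add: C_def w_def)
    qed
    finally have "cmod (v t) * F (Re (B (e t))) \<le> C * w t * F (Re (B (e t)))"
      by (rule mult_right_mono) fact
    then show ?thesis
      using abs_Re_eq_norm_mult_sqrt[OF v0, of t] by (simp add: F_def B_eq mult.assoc)
  qed
  have "integral {0..1} (\<lambda>t. \<bar>Re (v t)\<bar>) \<le> integral {0..1} (\<lambda>t. C * (w t * F (Re (B (e t)))))"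
  proof (rule integral_le)
    show "(\<lambda>t. \<bar>Re (v t)\<bar>) integrable_on {0..1}"
      unfolding v_def by (intro integrable_continuous_real continuous_intros cont_e) auto
    show "(\<lambda>t. C * (w t * F (Re (B (e t))))) integrable_on {0..1}"
      unfolding F_def by (intro integrable_continuous_real continuous_intros cont_B cont_w) auto
  qed (use pointwise in simp)
  also have "\<dots> = C * (2 / pi)" by (simp add: F_int)
  finally show ?thesis by (simp add: v_def e_def C_def mult.commute)
qed

section \<open>The estimate for derivatives\<close>

text \<open>Rotating \<open>a\<close> and \<open>b\<close> in opposite directions by half the difference of their arguments aligns them.\<close>
lemma exists_unit_norm_add_eq:
  obtains c where "cmod c = 1" "cmod (c * a + cnj c * b) = cmod a + cmod b"
proof -
  define c where "c = cis ((Arg b - Arg a) / 2)"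
  have "c * a + cnj c * b = of_real (cmod a + cmod b) * cis ((Arg b + Arg a) / 2)"
  proof -
    have "c * cis (Arg a) = cis ((Arg b + Arg a) / 2)"
      "cnj c * cis (Arg b) = cis ((Arg b + Arg a) / 2)"
      by (simp_all add: c_def cis_mult cis_cnj field_simps)
    moreover have "c * a = of_real (cmod a) * (c * cis (Arg a))"
      "cnj c * b = of_real (cmod b) * (cnj c * cis (Arg b))"
      using rcis_cmod_Arg[of a] rcis_cmod_Arg[of b] by (simp_all add: rcis_def mult.left_commute)
    ultimately show ?thesis by (simp only: of_real_add distrib_right)
  qed
  then have "cmod (c * a + cnj c * b) = cmod a + cmod b"
    by (simp add: norm_mult flip: of_real_add)
  then show ?thesis by (intro that[of c]) (auto simp: c_def)
qed

text \<open>Conjugating the integrand and using \<open>cnj u = 1 / u\<close> on the circle turns it into a function that is holomorphic in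
  the disc and vanishes at the origin. The zero at the origin comes from the factor \<open>u ^ Suc m\<close>, so the exponent of the kernel
  must be at least two.\<close>
lemma has_integral_cnj_mult_Cauchy_kernel:
  assumes h: "continuous_on (cball 0 1) h" "h holomorphic_on ball 0 1" and z: "z \<in> ball 0 1"
  shows "((\<lambda>t. cnj (h (cis (2*pi*t))) * (cis (2*pi*t) / (cis (2*pi*t) - z) ^ Suc (Suc m)))
            has_integral 0) {0..1}"
proof -
  define k where "k = (\<lambda>u. u * (h u * u ^ m / (1 - cnj z * u) ^ Suc (Suc m)))"
  have den: "1 - cnj z * u \<noteq> 0" if "cmod u \<le> 1" for u
    using one_minus_cnj_mult_nonzero[OF _ that] z by simp
  have "((\<lambda>t. k (cis (2*pi*t)) * cis (2*pi*t) / (cis (2*pi*t) - 0) ^ Suc 0)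
          has_integral (deriv ^^ 0) k 0 / fact 0) {0..1}"
  proof (rule Cauchy_has_integral_unit_circle)
    show "continuous_on (cball 0 1) k"
      unfolding k_def using den by (intro continuous_intros h) auto
    show "k holomorphic_on ball 0 1"
      unfolding k_def using den by (intro holomorphic_intros h) auto
  qed simp
  then have "((\<lambda>t. k (cis (2*pi*t))) has_integral 0) {0..1}"
    by (simp add: k_def)
  then have "(cnj \<circ> (\<lambda>t. k (cis (2*pi*t))) has_integral cnj 0) {0..1}"
    by (subst has_integral_cnj)
  moreover have "cnj \<circ> (\<lambda>t. k (cis (2*pi*t))) =
      (\<lambda>t. cnj (h (cis (2*pi*t))) * (cis (2*pi*t) / (cis (2*pi*t) - z) ^ Suc (Suc m)))"
  proof
    fix t :: real
    define u where "u = cis (2*pi*t)"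
    have u: "u \<noteq> 0" "cnj u = 1 / u"
      by (auto simp: u_def cis_cnj divide_inverse)
    have "cnj (k u) = cnj (h u) * (cnj u ^ Suc m / (1 - z * cnj u) ^ Suc (Suc m))"
      by (simp add: k_def)
    also have "1 - z * cnj u = (u - z) / u" using u by (simp add: field_simps)
    finally have "cnj (k u) = cnj (h u) * ((1 / u) ^ Suc m / ((u - z) / u) ^ Suc (Suc m))"
      by (simp only: u(2))
    also have "(1 / u) ^ Suc m / ((u - z) / u) ^ Suc (Suc m) = u / (u - z) ^ Suc (Suc m)"
      using u(1) by (simp add: power_divide)
    finally show "(cnj \<circ> (\<lambda>t. k (cis (2*pi*t)))) t =
        cnj (h (cis (2*pi*t))) * (cis (2*pi*t) / (cis (2*pi*t) - z) ^ Suc (Suc m))"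
      by (simp only: u_def comp_def)
  qed
  ultimately show ?thesis by (simp only: complex_cnj_zero)
qed

text \<open>By Cauchy's formula and \<open>has_integral_cnj_mult_Cauchy_kernel\<close>, \<open>f = h + cnj g\<close> integrated against the kernel \<open>K\<close> sees only
  \<open>h\<close>, and integrated against \<open>cnj K\<close> only \<open>cnj g\<close>. After the choice of \<open>c\<close>, the sum of the
  two norms is a single integral of \<open>f\<close> against the real function \<open>2 * Re (c * K)\<close>.\<close>
lemma higher_deriv_bound_closed_disc:
  assumes h: "continuous_on (cball 0 1) h" "h holomorphic_on ball 0 1"
    and g: "continuous_on (cball 0 1) g" "g holomorphic_on ball 0 1"
    and bound: "\<And>u. cmod u = 1 \<Longrightarrow> cmod (h u + cnj (g u)) \<le> M"
    and z: "z \<in> ball 0 1" and n: "n \<ge> 1"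
  shows "cmod ((deriv ^^ n) h z) + cmod ((deriv ^^ n) g z)
          \<le> fact n * (4 * M) / pi * (1 / ((1 - cmod z) ^ n * (1 + cmod z)))"
proof -
  obtain m where m: "n = Suc m" using n by (cases n) auto
  define K where "K = (\<lambda>t. cis (2*pi*t) / (cis (2*pi*t) - z) ^ Suc (Suc m))"
  define f where "f = (\<lambda>u. h u + cnj (g u))"
  define a where "a = (deriv ^^ n) h z / fact n"
  define b where "b = cnj ((deriv ^^ n) g z / fact n)"
  have "((\<lambda>t. h (cis (2*pi*t)) * K t) has_integral a) {0..1}"
    using Cauchy_has_integral_unit_circle[OF h z, of n] by (simp add: K_def a_def m del: power_Suc)
  moreover have "((\<lambda>t. cnj (g (cis (2*pi*t))) * K t) has_integral 0) {0..1}"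
    unfolding K_def by (rule has_integral_cnj_mult_Cauchy_kernel[OF g z])
  ultimately have fK: "((\<lambda>t. f (cis (2*pi*t)) * K t) has_integral a) {0..1}"
    unfolding f_def distrib_right by (rule has_integral_add[where l=0, unfolded add_0_right])
  have "((\<lambda>t. g (cis (2*pi*t)) * K t) has_integral cnj b) {0..1}"
    using Cauchy_has_integral_unit_circle[OF g z, of n] by (simp add: K_def b_def m del: power_Suc)
  moreover have "((\<lambda>t. cnj (h (cis (2*pi*t))) * K t) has_integral 0) {0..1}"
    unfolding K_def by (rule has_integral_cnj_mult_Cauchy_kernel[OF h z])
  ultimately have "((\<lambda>t. cnj (f (cis (2*pi*t))) * K t) has_integral cnj b) {0..1}"
    unfolding f_def distrib_right complex_cnj_add complex_cnj_cnj
    by (subst add.commute) (rule has_integral_add[where l=0, unfolded add_0_right])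
  then have "(cnj \<circ> (\<lambda>t. cnj (f (cis (2*pi*t))) * K t) has_integral cnj (cnj b)) {0..1}"
    by (subst has_integral_cnj)
  then have fK': "((\<lambda>t. f (cis (2*pi*t)) * cnj (K t)) has_integral b) {0..1}"
    by (simp add: comp_def)
  obtain c where c: "cmod c = 1" "cmod (c * a + cnj c * b) = cmod a + cmod b"
    by (rule exists_unit_norm_add_eq)
  have "((\<lambda>t. c * (f (cis (2*pi*t)) * K t) + cnj c * (f (cis (2*pi*t)) * cnj (K t)))
     has_integral c * a + cnj c * b) {0..1}"
    by (intro has_integral_add has_integral_mult_right fK fK')
  moreover have "c * (f u * k) + cnj c * (f u * cnj k) = f u * of_real (2 * Re (c * k))" for u k
  proof -
    have "complex_of_real (2 * Re (c * k)) = c * k + cnj (c * k)"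
      by (simp only: complex_add_cnj)
    then show ?thesis by (simp only: complex_cnj_mult distrib_left mult_ac)
  qed
  ultimately have int: "((\<lambda>t. f (cis (2*pi*t)) * of_real (2 * Re (c * K t))) has_integral c * a + cnj c * b) {0..1}"
    by simp
  have cK: "(\<lambda>t. \<bar>Re (c * K t)\<bar>) integrable_on {0..1}"
  proof -
    have "cis (2*pi*t) - z \<noteq> 0" for t
      using z by (metis eq_iff_diff_eq_0 less_irrefl mem_ball_0 norm_cis)
    then show ?thesis
      unfolding K_def by (intro integrable_continuous_real continuous_intros) auto
  qed
  have "((\<lambda>t. (2 * M) * \<bar>Re (c * K t)\<bar>) has_integral (2 * M) * integral {0..1} (\<lambda>t. \<bar>Re (c * K t)\<bar>)) {0..1}"
    by (intro has_integral_mult_right integrable_integral cK)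
  then have "cmod (c * a + cnj c * b) \<le> (2 * M) * integral {0..1} (\<lambda>t. \<bar>Re (c * K t)\<bar>)"
  proof (rule has_integral_norm_le[OF int])
    fix t
    have "cmod (f (cis (2*pi*t)) * of_real (2 * Re (c * K t)))
        = cmod (f (cis (2*pi*t))) * (2 * \<bar>Re (c * K t)\<bar>)"
      by (simp only: norm_mult norm_of_real abs_mult abs_numeral)
    also have "\<dots> \<le> M * (2 * \<bar>Re (c * K t)\<bar>)"
      using bound[of "cis (2*pi*t)"] by (intro mult_right_mono) (auto simp: f_def)
    finally show "cmod (f (cis (2*pi*t)) * of_real (2 * Re (c * K t))) \<le> (2 * M) * \<bar>Re (c * K t)\<bar>"
      by simp
  qed
  also have "\<dots> \<le> (2 * M) * (2 / pi * (1 / ((1 - cmod z) ^ Suc m * (1 + cmod z))))"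
  proof (rule mult_left_mono)
    show "integral {0..1} (\<lambda>t. \<bar>Re (c * K t)\<bar>) \<le> 2 / pi * (1 / ((1 - cmod z) ^ Suc m * (1 + cmod z)))"
      unfolding K_def using z c by (intro integral_abs_Re_Cauchy_kernel_le) auto
    show "0 \<le> 2 * M" using order_trans[OF norm_ge_zero bound[of 1]] by simp
  qed
  finally have "cmod a + cmod b \<le> 4 * M / pi * (1 / ((1 - cmod z) ^ n * (1 + cmod z)))"
    by (simp add: c m)
  then have "fact n * (cmod a + cmod b) \<le> fact n * (4 * M / pi * (1 / ((1 - cmod z) ^ n * (1 + cmod z))))"
    by (intro mult_left_mono) auto
  moreover have "fact n * (cmod a + cmod b) = cmod ((deriv ^^ n) h z) + cmod ((deriv ^^ n) g z)"
    by (simp add: a_def b_def norm_divide field_simps)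
  ultimately show ?thesis by simp
qed

text \<open>The closed disc version applies to \<open>h (\<rho> * z)\<close> and \<open>g (\<rho> * z)\<close> for \<open>\<rho> < 1\<close>; the bound at the fixed point
  \<open>z\<close> does not involve \<open>\<rho>\<close>, so \<open>\<rho>\<close> may tend to \<open>1\<close>.\<close>
lemma higher_deriv_bound_disc:
  assumes h: "h holomorphic_on ball 0 1" and g: "g holomorphic_on ball 0 1"
    and bound: "\<And>u. u \<in> ball 0 1 \<Longrightarrow> cmod (h u + cnj (g u)) \<le> M"
    and z: "z \<in> ball 0 1" and n: "n \<ge> 1"
  shows "cmod ((deriv ^^ n) h z) + cmod ((deriv ^^ n) g z)
          \<le> fact n * (4 * M) / pi * (1 / ((1 - cmod z) ^ n * (1 + cmod z)))"
proof -
  define \<Phi> where "\<Phi> = (\<lambda>\<rho>::real. cmod (of_real \<rho> ^ n * (deriv ^^ n) h (of_real \<rho> * z))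
     + cmod (of_real \<rho> ^ n * (deriv ^^ n) g (of_real \<rho> * z)))"
  have scaled: "\<Phi> \<rho> \<le> fact n * (4 * M) / pi * (1 / ((1 - cmod z) ^ n * (1 + cmod z)))"
    if \<rho>: "0 < \<rho>" "\<rho> < 1" for \<rho>
  proof -
    have into: "of_real \<rho> * w \<in> ball 0 1" if "cmod w \<le> 1" for w
    proof -
      have "\<rho> * cmod w \<le> \<rho> * 1" using that \<rho> by (intro mult_left_mono) auto
      also have "\<dots> < 1" using \<rho> by simp
      finally show ?thesis using \<rho> by (simp add: norm_mult)
    qed
    have scale: "continuous_on (cball 0 1) (\<lambda>w. k (of_real \<rho> * w))"
        "(\<lambda>w. k (of_real \<rho> * w)) holomorphic_on ball 0 1"
        "(deriv ^^ n) (\<lambda>w. k (of_real \<rho> * w)) z = of_real \<rho> ^ n * (deriv ^^ n) k (of_real \<rho> * z)"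
      if k: "k holomorphic_on ball 0 1" for k :: "complex \<Rightarrow> complex"
    proof -
      have sub: "(\<lambda>w. of_real \<rho> * w) ` cball 0 1 \<subseteq> ball (0::complex) 1" using into by auto
      show "continuous_on (cball 0 1) (\<lambda>w. k (of_real \<rho> * w))"
        by (rule continuous_on_compose2[OF holomorphic_on_imp_continuous_on[OF k] _ sub])
          (intro continuous_intros)
      show "(\<lambda>w. k (of_real \<rho> * w)) holomorphic_on ball 0 1"
        using into by (intro holomorphic_on_compose_gen[unfolded comp_def, OF _ k] holomorphic_intros) auto
      show "(deriv ^^ n) (\<lambda>w. k (of_real \<rho> * w)) z = of_real \<rho> ^ n * (deriv ^^ n) k (of_real \<rho> * z)"
        using into by (intro higher_deriv_compose_linear[OF k _ _ z]) auto
    qed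
    have "cmod (h (of_real \<rho> * u) + cnj (g (of_real \<rho> * u))) \<le> M" if "cmod u = 1" for u
      using that by (intro bound into) simp
    then have "cmod ((deriv ^^ n) (\<lambda>w. h (of_real \<rho> * w)) z) + cmod ((deriv ^^ n) (\<lambda>w. g (of_real \<rho> * w)) z)
        \<le> fact n * (4 * M) / pi * (1 / ((1 - cmod z) ^ n * (1 + cmod z)))"
      by (rule higher_deriv_bound_closed_disc[OF scale(1,2)[OF h] scale(1,2)[OF g] _ z n])
    then show ?thesis
      by (simp only: \<Phi>_def scale(3)[OF h] scale(3)[OF g])
  qed
  have cont: "isCont (\<lambda>\<rho>::real. (deriv ^^ n) k (of_real \<rho> * z)) 1"
    if "k holomorphic_on ball 0 1" for k
  proof -
    have "continuous_on (ball 0 1) ((deriv ^^ n) k)"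
      by (intro holomorphic_on_imp_continuous_on holomorphic_higher_deriv that open_ball)
    then have outer: "isCont ((deriv ^^ n) k) (of_real 1 * z)"
      using z by (simp add: continuous_on_eq_continuous_at)
    have inner: "isCont (\<lambda>\<rho>::real. of_real \<rho> * z) 1"
      by (intro continuous_intros)
    show ?thesis by (rule isCont_o2[OF inner outer])
  qed
  have "isCont \<Phi> 1"
    unfolding \<Phi>_def by (intro continuous_intros cont h g)
  then have "(\<Phi> \<longlongrightarrow> \<Phi> 1) (at_left 1)"
    by (simp add: isCont_def filterlim_at_split)
  moreover have "\<forall>\<^sub>F \<rho> in at_left 1. \<Phi> \<rho> \<le> fact n * (4 * M) / pi * (1 / ((1 - cmod z) ^ n * (1 + cmod z)))"
    using scaled unfolding eventually_at_left_field by (intro exI[of _ 0]) auto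
  ultimately have "\<Phi> 1 \<le> fact n * (4 * M) / pi * (1 / ((1 - cmod z) ^ n * (1 + cmod z)))"
    by (rule tendsto_upperbound) simp
  then show ?thesis by (simp add: \<Phi>_def)
qed

section \<open>Sharpness at the origin and the conclusion\<close>

text \<open>Only the linear term of \<open>L\<close> contributes to the coefficient of \<open>z ^ n\<close>. Splitting off that factor
  as \<open>L (z ^ n) = z ^ n * q (z ^ n)\<close>, one sees this from Leibniz' rule.\<close>
lemma higher_deriv_comp_power_0:
  assumes L: "L holomorphic_on ball 0 1" and L0: "L 0 = 0" and n: "n \<ge> 1"
  shows "(deriv ^^ n) (\<lambda>z. L (z ^ n)) 0 = fact n * deriv L 0"
proof -
  define q where "q = (\<lambda>w. if w = 0 then deriv L 0 else L w / w)"
  have q: "q holomorphic_on ball 0 1"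
    by (rule pole_theorem_open_0[OF L open_ball, of 0]) (auto simp: q_def L0)
  have pow_in: "z ^ n \<in> ball 0 1" if "z \<in> ball 0 1" for z :: complex
    using that n by (simp add: norm_power power_less_one_iff)
  have qn: "(\<lambda>z. q (z ^ n)) holomorphic_on ball 0 1"
    using pow_in by (intro holomorphic_on_compose_gen[unfolded comp_def, OF _ q] holomorphic_intros) auto
  have eq: "L w = w * q w" for w by (simp add: q_def L0)
  have "(deriv ^^ n) (\<lambda>z. L (z ^ n)) 0 = (deriv ^^ n) (\<lambda>z. z ^ n * q (z ^ n)) 0"
    by (simp add: eq)
  also have "\<dots> = (\<Sum>j = 0..n. of_nat (n choose j) * (deriv ^^ j) (\<lambda>z. z ^ n) 0
                    * (deriv ^^ (n - j)) (\<lambda>z. q (z ^ n)) 0)"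
    by (rule higher_deriv_mult[OF _ qn]) (auto intro!: holomorphic_intros)
  also have "\<dots> = (\<Sum>j = 0..n. if j = n then fact n * deriv L 0 else 0)"
  proof (rule sum.cong)
    fix j assume j: "j \<in> {0..n}"
    have "(deriv ^^ j) (\<lambda>z. z ^ n) 0 = pochhammer (of_nat (Suc n - j)) j * (0::complex) ^ (n - j)"
      using higher_deriv_power[of j 0 n 0] by simp
    then show "of_nat (n choose j) * (deriv ^^ j) (\<lambda>z. z ^ n) 0 * (deriv ^^ (n - j)) (\<lambda>z. q (z ^ n)) 0
        = (if j = n then fact n * deriv L 0 else 0)"
      using j n by (auto simp: power_0_left pochhammer_fact q_def)
  qed simp
  also have "\<dots> = fact n * deriv L 0" by simp
  finally show ?thesis .
qed

text \<open>Equality at the origin requires boundary values \<open>\<plusminus>M\<close> with the sign of \<open>cos (2*pi*n*t)\<close>, up to a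
  rotation. The function \<open>(2*M/pi) * Arg ((1 + z ^ n) / (1 - z ^ n))\<close> has such boundary values, because
  \<open>(1 + w) / (1 - w)\<close> maps the disc to the right half plane. It is \<open>h + cnj h\<close> for the
  holomorphic \<open>h\<close> built from the logarithm.\<close>
lemma exists_extremal_harmonic:
  assumes M: "M > 0" and n: "n \<ge> 1"
  obtains f where "harmonic_on f (ball 0 1)" "\<And>z. z \<in> ball 0 1 \<Longrightarrow> cmod (f z) \<le> M"
    "cmod ((wirtinger_dz ^^ n) f 0) + cmod ((wirtinger_dzbar ^^ n) f 0) = fact n * (4 * M) / pi"
proof -
  define L where "L = (\<lambda>w. - \<i> * of_real (M / pi) * Ln ((1 + w) / (1 - w)))"
  define h where "h = (\<lambda>z. L (z ^ n))"
  define f where "f = (\<lambda>z. h z + cnj (h z))"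
  have half_plane: "Re ((1 + w) / (1 - w)) > 0" if "w \<in> ball 0 1" for w :: complex
  proof -
    have "Re ((1 + w) / (1 - w)) = (1 - cmod w ^ 2) / cmod (1 - w) ^ 2"
      by (simp add: Re_divide cmod_power2) (simp add: algebra_simps power2_eq_square)
    moreover have "cmod w ^ 2 < 1" using that by (simp add: power_less_one_iff)
    moreover have "cmod (1 - w) > 0" using that by auto
    ultimately show ?thesis by simp
  qed
  have slit: "(1 + w) / (1 - w) \<notin> \<real>\<^sub>\<le>\<^sub>0" if "w \<in> ball 0 1" for w :: complex
    using half_plane[OF that] by (metis complex_nonpos_Reals_iff not_less)
  have ne: "1 - w \<noteq> 0" if "w \<in> ball 0 1" for w :: complex
    using that by auto
  have L: "L holomorphic_on ball 0 1"
    unfolding L_def by (intro holomorphic_intros slit ne)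
  have pow_in: "z ^ n \<in> ball 0 1" if "z \<in> ball 0 1" for z :: complex
    using that n by (simp add: norm_power power_less_one_iff)
  have h: "h holomorphic_on ball 0 1"
    unfolding h_def using pow_in
    by (intro holomorphic_on_compose_gen[unfolded comp_def, OF _ L] holomorphic_intros) auto
  have "(L has_field_derivative - \<i> * of_real (M / pi) * 2) (at 0)"
    unfolding L_def by (auto intro!: derivative_eq_intros)
  then have "deriv L 0 = - \<i> * of_real (M / pi) * 2" by (rule DERIV_imp_deriv)
  moreover have "(deriv ^^ n) h 0 = fact n * deriv L 0"
    unfolding h_def by (rule higher_deriv_comp_power_0[OF L _ n]) (simp add: L_def)
  ultimately have norm_h: "cmod ((deriv ^^ n) h 0) = fact n * (2 * M) / pi"
    using M by (simp add: norm_mult norm_divide)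
  obtain m where m: "n = Suc m" using n by (cases n) auto
  have "(wirtinger_dz ^^ n) f 0 = (deriv ^^ n) h 0"
       "(wirtinger_dzbar ^^ n) f 0 = cnj ((deriv ^^ n) h 0)"
    using higher_wirtinger_holomorphic_add_cnj[OF open_ball h h, of f 0 m]
    by (simp_all add: f_def m del: funpow.simps)
  then have "cmod ((wirtinger_dz ^^ n) f 0) + cmod ((wirtinger_dzbar ^^ n) f 0) = fact n * (4 * M) / pi"
    by (simp add: norm_h)
  moreover have "harmonic_on f (ball 0 1)"
    unfolding f_def by (rule harmonic_on_holomorphic_add_cnj[OF open_ball h h])
  moreover have "cmod (f z) \<le> M" if z: "z \<in> ball 0 1" for z
  proof -
    define y where "y = (1 + z ^ n) / (1 - z ^ n)"
    have "Re y > 0" unfolding y_def by (intro half_plane pow_in z)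
    then have "\<bar>Im (Ln y)\<bar> \<le> pi / 2" using Re_Ln_pos_lt[of y] by force
    then have *: "2 * (M / pi) * \<bar>Im (Ln y)\<bar> \<le> 2 * (M / pi) * (pi / 2)"
      using M by (intro mult_left_mono) auto
    have "f z = of_real (2 * (M / pi) * Im (Ln y))"
      by (simp add: f_def h_def L_def y_def complex_eq_iff)
    then have "cmod (f z) = 2 * (M / pi) * \<bar>Im (Ln y)\<bar>"
      using M by (simp only: norm_of_real abs_mult) simp
    also note *
    finally show ?thesis by simp
  qed
  ultimately show ?thesis by (intro that)
qed

theorem theorem1:
  fixes M :: real
  assumes "M > 0"
  shows "(\<forall>f :: complex \<Rightarrow> complex.
            harmonic_on f (ball 0 1) \<and> (\<forall>z\<in>ball 0 1. norm (f z) \<le> M) \<longrightarrow>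
            (\<forall>n::nat. n \<ge> 1 \<longrightarrow> (\<forall>z\<in>ball 0 1.
               norm ((wirtinger_dz ^^ n) f z) + norm ((wirtinger_dzbar ^^ n) f z)
                 \<le> fact n * (4 * M) / pi * (1 / ((1 - norm z) ^ n * (1 + norm z)))))) \<and>
         (\<forall>n::nat. n \<ge> 1 \<longrightarrow> (\<exists>f :: complex \<Rightarrow> complex.
            harmonic_on f (ball 0 1) \<and> (\<forall>z\<in>ball 0 1. norm (f z) \<le> M) \<and>
            norm ((wirtinger_dz ^^ n) f 0) + norm ((wirtinger_dzbar ^^ n) f 0)
              = fact n * (4 * M) / pi))"
proof (intro conjI allI impI ballI)
  fix f :: "complex \<Rightarrow> complex" and n :: nat and z :: complex
  assume f: "harmonic_on f (ball 0 1) \<and> (\<forall>z\<in>ball 0 1. norm (f z) \<le> M)"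
    and n: "n \<ge> 1" and z: "z \<in> ball 0 1"
  obtain h g where h: "h holomorphic_on ball 0 1" and g: "g holomorphic_on ball 0 1"
    and fhg: "\<And>w. w \<in> ball 0 1 \<Longrightarrow> f w = h w + cnj (g w)"
    using harmonic_on_convex_decomposition f convex_ball by blast
  obtain m where m: "n = Suc m" using n by (cases n) auto
  have "norm ((wirtinger_dz ^^ n) f z) = norm ((deriv ^^ n) h z)"
    "norm ((wirtinger_dzbar ^^ n) f z) = norm ((deriv ^^ n) g z)"
    using higher_wirtinger_holomorphic_add_cnj[OF open_ball h g fhg z, of m]
    by (simp_all only: m complex_mod_cnj)
  moreover have "norm (h w + cnj (g w)) \<le> M" if "w \<in> ball 0 1" for w
    using f fhg[OF that] that by metis
  ultimately show "norm ((wirtinger_dz ^^ n) f z) + norm ((wirtinger_dzbar ^^ n) f z)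
                 \<le> fact n * (4 * M) / pi * (1 / ((1 - norm z) ^ n * (1 + norm z)))"
    using higher_deriv_bound_disc[OF h g _ z n] by simp
next
  fix n :: nat
  assume "n \<ge> 1"
  obtain f where "harmonic_on f (ball 0 1)" "\<And>z. z \<in> ball 0 1 \<Longrightarrow> cmod (f z) \<le> M"
    "cmod ((wirtinger_dz ^^ n) f 0) + cmod ((wirtinger_dzbar ^^ n) f 0) = fact n * (4 * M) / pi"
    using exists_extremal_harmonic[OF assms \<open>n \<ge> 1\<close>] by blast
  then show "\<exists>f :: complex \<Rightarrow> complex.
            harmonic_on f (ball 0 1) \<and> (\<forall>z\<in>ball 0 1. norm (f z) \<le> M) \<and>
            norm ((wirtinger_dz ^^ n) f 0) + norm ((wirtinger_dzbar ^^ n) f 0)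
              = fact n * (4 * M) / pi" by blast
qed

end
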